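(* Let $\beta_1,\beta_2,\dots$ be an enumeration of $\mathbb{Q}/\mathbb{Z}$, i.e. $n\mapsto\beta_n$ is a bijection from the positive integers onto $\mathbb{Q}/\mathbb{Z}$. Then the enumeration is admissible if and only if, for every positive integer $n$, the function $f_{\beta_n}$ is $\mathcal{B}_n$-measurable.
   Context: Every $\beta\in\mathbb{Q}/\mathbb{Z}$ can be written $\beta=a/q$ with $q\ge1$ and $\gcd(a,q)=1$; its height is $h(\beta)=q$. Put $\mathcal{F}_Q=\{\beta:h(\beta)\le Q\}$. For distinct $a,b\in\mathbb{R}/\mathbb{Z}$, $I(a,b)$ is the open arc from $a$ to $b$ in the positive direction, i.e. $\{a+t\bmod1:0<t<d\}$ with $d\in(0,1)$, $d\equiv b-a\pmod1$. $\overline{I}(a,b)$ is its closure. For $\beta\ne0$ with $h(\beta)=Q$: $\beta'$ is the unique point of $\mathcal{F}_Q$ with $I(\beta',\beta)\cap\mathcal{F}_Q=\emptyset$, and $\beta''$ is the unique point of $\mathcal{F}_Q$ with $I(\beta,\beta'')\cap\mathcal{F}_Q=\emptyset$. Let $\psi(x)=x-[x]-\frac12$ for $x\notin\mathbb{Z}$ and $\psi(x)=0$ for $x\in\mathbb{Z}$. Define $f_0\equiv1$ and, for $\beta\ne0$, $f_\beta(x)=h(\beta)\psi(x-\beta)-h(\beta')\psi(x-\beta')-h(\beta'')\psi(x-\beta'')$. An enumeration $\beta_1,\beta_2,\dots$ of $\mathbb{Q}/\mathbb{Z}$ is admissible if all three of the following hold: (i) $\beta_1=0$; (ii) whenever $m\ge2$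 and $\beta_k=\beta_m'$, we have $k<m$; (iii) whenever $m\ge2$ and $\beta_l=\beta_m''$, we have $l<m$. $\mathcal{B}_n$ is the finite $\sigma$-algebra of subsets of $\mathbb{R}/\mathbb{Z}$ generated by the connected components of $\mathbb{R}/\mathbb{Z}\setminus\{\beta_1,\dots,\beta_n\}$ together with the singletons $\{\beta_1\},\dots,\{\beta_n\}$. *)

theory Defs
  imports "HOL-Analysis.Analysis"
begin

quotient_type circle = real / "\<lambda>x y :: real. x - y \<in> \<int>"
  morphisms rep_circle circle_of
proof (rule equivpI)
  show "reflp (\<lambda>x y :: real. x - y \<in> \<int>)"
    by (simp add: reflp_def)
  show "symp (\<lambda>x y :: real. x - y \<in> \<int>)"
    by (metis (mono_tags, lifting) Ints_minus minus_diff_eq sympI)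
  show "transp (\<lambda>x y :: real. x - y \<in> \<int>)"
  proof (rule transpI)
    fix x y z :: real
    assume "x - y \<in> \<int>" "y - z \<in> \<int>"
    then have "(x - y) + (y - z) \<in> \<int>" by (rule Ints_add)
    then show "x - z \<in> \<int>" by simp
  qed
qed

instantiation circle :: ab_group_add
begin

lift_definition zero_circle :: circle is "0 :: real" .

lift_definition plus_circle :: "circle \<Rightarrow> circle \<Rightarrow> circle" is "(+) :: real \<Rightarrow> real \<Rightarrow> real"
  by (metis Ints_add add_diff_add)

lift_definition uminus_circle :: "circle \<Rightarrow> circle" is "uminus :: real \<Rightarrow> real"
  by (metis Ints_minus minus_diff_minus)

definition minus_circle :: "circle \<Rightarrow> circle \<Rightarrow> circle" where
  "minus_circle a b = a + (- b)"

instance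
proof
  fix a b c :: circle
  show "a + b + c = a + (b + c)" by transfer (simp add: add.assoc)
  show "a + b = b + a" by transfer (simp add: add.commute)
  show "0 + a = a" by transfer simp
  show "- a + a = 0" by transfer simp
  show "a - b = a + (- b)" by (rule minus_circle_def)
qed

end

instantiation circle :: topological_space
begin

definition open_circle :: "circle set \<Rightarrow> bool" where
  "open_circle U \<longleftrightarrow> open (circle_of -` U)"

instance
proof
  show "open (UNIV :: circle set)" by (simp add: open_circle_def)
next
  fix S T :: "circle set"
  assume "open S" "open T"
  then show "open (S \<inter> T)" by (simp add: open_circle_def open_Int)
next
  fix K :: "circle set set"
  assume "\<forall>S\<in>K. open S"
  then show "open (\<Union>K)" by (auto simp: open_circle_def vimage_Union)
qed

end

definition QmodZ :: "circle set" where
  "QmodZ = circle_of ` \<rat>"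

definition height :: "circle \<Rightarrow> nat" where
  "height \<beta> = (THE q. q \<ge> 1 \<and>
     (\<exists>a :: int. coprime a (int q) \<and> \<beta> = circle_of (real_of_int a / real q)))"

definition farey :: "nat \<Rightarrow> circle set" where
  "farey Q = {\<beta> \<in> QmodZ. height \<beta> \<le> Q}"

text \<open>Meaningful for distinct endpoints only; for equal endpoints the set below is empty, which is
  why distinctness is required explicitly in the two definitions that follow.\<close>

definition arc_open :: "circle \<Rightarrow> circle \<Rightarrow> circle set" where
  "arc_open a b = {a + circle_of t | t d. 0 < t \<and> t < d \<and> d < 1 \<and> circle_of d = b - a}"

definition farey_pred :: "circle \<Rightarrow> circle" where
  "farey_pred \<beta> = (THE \<gamma>. \<gamma> \<in> farey (height \<beta>) \<and> \<gamma> \<noteq> \<beta> \<and>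
     arc_open \<gamma> \<beta> \<inter> farey (height \<beta>) = {})"

definition farey_succ :: "circle \<Rightarrow> circle" where
  "farey_succ \<beta> = (THE \<gamma>. \<gamma> \<in> farey (height \<beta>) \<and> \<gamma> \<noteq> \<beta> \<and>
     arc_open \<beta> \<gamma> \<inter> farey (height \<beta>) = {})"

definition psi_real :: "real \<Rightarrow> real" where
  "psi_real x = (if x \<in> \<int> then 0 else x - of_int \<lfloor>x\<rfloor> - 1 / 2)"

lift_definition psi :: "circle \<Rightarrow> real" is psi_real
proof -
  fix x y :: real
  assume "x - y \<in> \<int>"
  then obtain k where "x - y = of_int k" by (auto elim: Ints_cases)
  then have "x = y + of_int k" by simp
  then show "psi_real x = psi_real y" by (simp add: psi_real_def)
qed

definition farey_fun :: "circle \<Rightarrow> circle \<Rightarrow> real" where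
  "farey_fun \<beta> x = (if \<beta> = 0 then 1 else
     real (height \<beta>) * psi (x - \<beta>)
       - real (height (farey_pred \<beta>)) * psi (x - farey_pred \<beta>)
       - real (height (farey_succ \<beta>)) * psi (x - farey_succ \<beta>))"

text \<open>Sequences are indexed by the positive integers; the value at 0 is irrelevant.\<close>

definition enumeration :: "(nat \<Rightarrow> circle) \<Rightarrow> bool" where
  "enumeration \<beta> \<longleftrightarrow> bij_betw \<beta> {1..} QmodZ"

definition admissible :: "(nat \<Rightarrow> circle) \<Rightarrow> bool" where
  "admissible \<beta> \<longleftrightarrow>
     \<beta> 1 = 0 \<and>
     (\<forall>m k. m \<ge> 2 \<and> k \<ge> 1 \<and> \<beta> k = farey_pred (\<beta> m) \<longrightarrow> k < m) \<and>
     (\<forall>m l. m \<ge> 2 \<and> l \<ge> 1 \<and> \<beta> l = farey_succ (\<beta> m) \<longrightarrow> l < m)"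

definition B_alg :: "(nat \<Rightarrow> circle) \<Rightarrow> nat \<Rightarrow> circle measure" where
  "B_alg \<beta> n = sigma UNIV
     (components (UNIV - \<beta> ` {1..n}) \<union> {{\<beta> i} | i. i \<in> {1..n}})"

end

theory Submission
  imports Defs
begin

text \<open>
  The neighbours of \<open>\<beta> = a/q\<close> in the Farey set of order \<open>q\<close> have denominators summing to \<open>q\<close>, so
  the slopes in \<open>f\<^sub>\<beta>\<close> cancel and \<open>f\<^sub>\<beta>\<close> is a step function: locally constant away from
  \<open>\<beta>, \<beta>', \<beta>''\<close>, with a genuine jump at \<open>\<beta>'\<close> and at \<open>\<beta>''\<close>. On the other hand, a function is
  measurable for \<open>B\<^sub>n\<close> iff it is constant on the components of the complement of
  \<open>{\<beta>\<^sub>1, \<dots>, \<beta>\<^sub>n}\<close>. Hence \<open>f\<close> at \<open>\<beta>\<^sub>n \<noteq> 0\<close> is \<open>B\<^sub>n\<close>-measurable iff both neighbours of \<open>\<beta>\<^sub>n\<close> occur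
  among \<open>\<beta>\<^sub>1, \<dots>, \<beta>\<^sub>n\<close>, which for \<open>n = 1\<close> is impossible.
\<close>

section \<open>The circle\<close>

lemma circle_of_eq_iff: "circle_of x = circle_of y \<longleftrightarrow> x - y \<in> \<int>"
  by (rule circle.abs_eq_iff)

lemma circle_of_add: "circle_of (x + y) = circle_of x + circle_of y"
  by (simp add: plus_circle.abs_eq)

lemma circle_of_diff: "circle_of (x - y) = circle_of x - circle_of y"
  by (metis add_diff_cancel_right' circle_of_add diff_add_cancel)

lemma circle_of_eq_0_iff: "circle_of x = 0 \<longleftrightarrow> x \<in> \<int>"
  by (simp add: zero_circle.abs_eq circle_of_eq_iff)

lemma circle_of_surj: obtains x where "c = circle_of x"
  by (metis Quotient_abs_rep Quotient_circle)

lemma circle_of_unit_repr: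
  assumes "c \<noteq> 0"
  obtains d where "0 < d" "d < 1" "c = circle_of d"
proof -
  obtain x where x: "c = circle_of x" by (rule circle_of_surj)
  have "c = circle_of (frac x)"
    by (simp add: x circle_of_eq_iff frac_def)
  moreover have "x \<notin> \<int>" using assms x circle_of_eq_0_iff by auto
  then have "0 < frac x" by simp
  ultimately show ?thesis using that frac_lt_1 by blast
qed

lemma circle_of_unit_inj:
  assumes "circle_of d = circle_of e" "0 < d" "d < 1" "0 < e" "e < 1"
  shows "d = e"
proof -
  obtain k where k: "d - e = of_int k"
    using assms(1) circle_of_eq_iff by (auto elim: Ints_cases)
  then have "real_of_int k < 1" "real_of_int k > -1" using assms by linarith+
  then have "k = 0" by linarith
  then show ?thesis using k by simp
qed

lemma continuous_on_circle_of: "continuous_on A circle_of"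
  by (rule continuous_on_subset[OF _ subset_UNIV])
    (simp add: continuous_on_open_vimage open_circle_def[symmetric])

lemma floor_eventually_const:
  fixes r :: real
  assumes "r \<notin> \<int>"
  shows "\<forall>\<^sub>F e in nhds 0. r + e \<notin> \<int> \<and> \<lfloor>r + e\<rfloor> = \<lfloor>r\<rfloor>"
proof -
  \<comment> \<open>The distance from \<open>r\<close> to the nearest integer.\<close>
  define s where "s = min (frac r) (1 - frac r)"
  have "s > 0" using assms frac_lt_1[of r] by (simp add: s_def)
  moreover have "r + e \<notin> \<int> \<and> \<lfloor>r + e\<rfloor> = \<lfloor>r\<rfloor>" if "\<bar>e\<bar> < s" for e
  proof -
    have "of_int \<lfloor>r\<rfloor> < r + e" "r + e < of_int \<lfloor>r\<rfloor> + 1"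
      using that by (auto simp: s_def frac_def)
    moreover from this have "\<lfloor>r + e\<rfloor> = \<lfloor>r\<rfloor>" by (simp add: floor_unique)
    ultimately have "\<lfloor>r + e\<rfloor> = \<lfloor>r\<rfloor>" "r + e \<noteq> of_int \<lfloor>r + e\<rfloor>" by auto
    then show ?thesis by (metis Ints_cases floor_of_int)
  qed
  ultimately show ?thesis
    unfolding eventually_nhds_metric by (auto simp: dist_real_def)
qed

lemma eventually_ne_circle_of:
  assumes "c \<noteq> b"
  shows "\<forall>\<^sub>F e in nhds 0. c + circle_of e \<noteq> b"
proof -
  obtain r where r: "c - b = circle_of r" by (rule circle_of_surj)
  then have "r \<notin> \<int>" using assms circle_of_eq_0_iff[of r] by auto
  from floor_eventually_const[OF this] show ?thesis
  proof eventually_elim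
    case (elim e)
    then have "circle_of r + circle_of e \<noteq> 0"
      by (simp add: circle_of_add[symmetric] circle_of_eq_0_iff)
    then show ?case using r by (auto simp: algebra_simps)
  qed
qed

text \<open>Only finitely many points have to be avoided, so one radius serves them all.
  Connectedness is what is used later: it puts the whole arc inside a single component of the
  complement of \<open>S\<close>.\<close>

lemma connected_neighbourhood_avoiding:
  assumes "finite S" "c \<notin> S"
  obtains d where "d > 0" "connected ((\<lambda>e. c + circle_of e) ` {-d<..<d})"
    "(\<lambda>e. c + circle_of e) ` {-d<..<d} \<subseteq> UNIV - S"
proof -
  have "\<forall>\<^sub>F e in nhds 0. \<forall>b\<in>S. c + circle_of e \<noteq> b"
    using assms by (intro eventually_ball_finite ballI eventually_ne_circle_of) auto
  then obtain d where d: "d > 0" "\<And>e b. \<bar>e\<bar> < d \<Longrightarrow> b \<in> S \<Longrightarrow> c + circle_of e \<noteq> b"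
    unfolding eventually_nhds_metric by (auto simp: dist_real_def)
  obtain r where r: "c = circle_of r" by (rule circle_of_surj)
  have "continuous_on {-d<..<d} (\<lambda>e. circle_of (r + e))"
    by (rule continuous_on_compose2[OF continuous_on_circle_of[of UNIV]])
      (auto intro: continuous_intros)
  then have "connected ((\<lambda>e. c + circle_of e) ` {-d<..<d})"
    unfolding r circle_of_add[symmetric] by (rule connected_continuous_image) simp
  moreover have "c + circle_of e \<notin> S" if "e \<in> {-d<..<d}" for e
    using d(2)[of e] that by (auto simp: abs_less_iff)
  ultimately show ?thesis using that d(1) by blast
qed

section \<open>Heights and Farey neighbours\<close>

text \<open>Shifting by an integer changes the numerator only, so two reduced representations of one
  point have denominators that divide each other.\<close>

lemma height_circle_of:
  fixes a :: int
  assumes "q \<ge> 1" "coprime a (int q)"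
  shows "height (circle_of (real_of_int a / real q)) = q"
  unfolding height_def
proof (rule the_equality)
  fix p :: nat
  assume "1 \<le> p \<and> (\<exists>b. coprime b (int p) \<and>
    circle_of (real_of_int a / real q) = circle_of (real_of_int b / real p))"
  then obtain b where p: "p \<ge> 1" "coprime b (int p)"
    and "real_of_int a / real q - real_of_int b / real p \<in> \<int>"
    by (auto simp: circle_of_eq_iff)
  then obtain k where "real_of_int a / real q - real_of_int b / real p = of_int k"
    by (auto elim: Ints_cases)
  then have "real_of_int a * real p = (real_of_int b + of_int k * real p) * real q"
    using p assms by (simp add: field_simps)
  then have eq: "a * int p = (b + k * int p) * int q"
    by (metis (mono_tags, lifting) of_int_add of_int_eq_iff of_int_mult of_int_of_nat_eq)
  have "int q dvd a * int p" unfolding eq by simp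
  then have "int q dvd int p"
    using assms(2) by (metis coprime_commute coprime_dvd_mult_right_iff)
  moreover have "int p dvd (b + k * int p) * int q" unfolding eq[symmetric] by simp
  then have "int p dvd b * int q"
    by (metis distrib_right dvd_add_left_iff dvd_mult dvd_mult2 dvd_refl)
  then have "int p dvd int q"
    using p(2) by (metis coprime_commute coprime_dvd_mult_right_iff)
  ultimately show "p = q" by (simp add: dvd_antisym)
qed (use assms in auto)

lemma QmodZ_repr:
  assumes "\<beta> \<in> QmodZ"
  obtains a :: int where "height \<beta> \<ge> 1" "coprime a (int (height \<beta>))"
    "\<beta> = circle_of (real_of_int a / real (height \<beta>))"
proof -
  obtain x where x: "x \<in> \<rat>" "\<beta> = circle_of x" using assms by (auto simp: QmodZ_def)
  obtain b q where "x = real_of_int b / real_of_int q" "q > 0" "coprime b q"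
    using x(1) by (auto elim!: Rats_cases')
  then have "nat q \<ge> 1" "coprime b (int (nat q))" "\<beta> = circle_of (real_of_int b / real (nat q))"
    using x(2) by auto
  then show ?thesis using that height_circle_of by metis
qed

lemma circle_of_rat_in_QmodZ: "circle_of (real_of_int a / real q) \<in> QmodZ"
  by (auto simp: QmodZ_def)

text \<open>Compare the distances in (0,1) from the two points to \<beta>, in a fixed direction: the
  nearer point lies on the arc between the farther one and \<beta>. This makes Farey neighbours
  unique.\<close>

lemma arc_open_total:
  assumes "\<gamma> \<noteq> \<delta>" "\<gamma> \<noteq> \<beta>" "\<delta> \<noteq> \<beta>"
  shows "\<gamma> \<in> arc_open \<delta> \<beta> \<or> \<delta> \<in> arc_open \<gamma> \<beta>"
    and "\<gamma> \<in> arc_open \<beta> \<delta> \<or> \<delta> \<in> arc_open \<beta> \<gamma>"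
proof -
  have *: "\<gamma> \<in> arc_open \<delta> \<beta>"
    if "\<beta> - \<gamma> = circle_of d" "\<beta> - \<delta> = circle_of e" "0 < d" "d < e" "e < 1" for \<gamma> \<delta> d e
  proof -
    have "\<gamma> = \<delta> + circle_of (e - d)"
      unfolding circle_of_diff that(1,2)[symmetric] by simp
    then show ?thesis unfolding arc_open_def
      using that by (intro CollectI exI[of _ "e - d"] exI[of _ e]) auto
  qed
  obtain d where d: "0 < d" "d < 1" "\<beta> - \<gamma> = circle_of d"
    using circle_of_unit_repr[of "\<beta> - \<gamma>"] assms by auto
  obtain e where e: "0 < e" "e < 1" "\<beta> - \<delta> = circle_of e"
    using circle_of_unit_repr[of "\<beta> - \<delta>"] assms by auto
  have "d \<noteq> e" using d e assms(1) by (metis diff_eq_eq diff_add_cancel add_left_cancel)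
  then show "\<gamma> \<in> arc_open \<delta> \<beta> \<or> \<delta> \<in> arc_open \<gamma> \<beta>"
    using *[of \<gamma> d \<delta> e] *[of \<delta> e \<gamma> d] d e by (cases d e rule: linorder_cases) auto
  have *: "\<gamma> \<in> arc_open \<beta> \<delta>"
    if "\<gamma> - \<beta> = circle_of d" "\<delta> - \<beta> = circle_of e" "0 < d" "d < e" "e < 1" for \<gamma> \<delta> d e
  proof -
    have "\<gamma> = \<beta> + circle_of d" unfolding that(1)[symmetric] by simp
    then show ?thesis unfolding arc_open_def
      using that by (intro CollectI exI[of _ d] exI[of _ e]) auto
  qed
  obtain d where d: "0 < d" "d < 1" "\<gamma> - \<beta> = circle_of d"
    using circle_of_unit_repr[of "\<gamma> - \<beta>"] assms by auto
  obtain e where e: "0 < e" "e < 1" "\<delta> - \<beta> = circle_of e"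
    using circle_of_unit_repr[of "\<delta> - \<beta>"] assms by auto
  have "d \<noteq> e" using d e assms(1) by (metis diff_add_cancel)
  then show "\<gamma> \<in> arc_open \<beta> \<delta> \<or> \<delta> \<in> arc_open \<beta> \<gamma>"
    using *[of \<gamma> d \<delta> e] *[of \<delta> e \<gamma> d] d e by (cases d e rule: linorder_cases) auto
qed

lemma farey_pred_eqI:
  assumes "\<gamma> \<in> farey (height \<beta>)" "\<gamma> \<noteq> \<beta>" "arc_open \<gamma> \<beta> \<inter> farey (height \<beta>) = {}"
  shows "farey_pred \<beta> = \<gamma>"
  unfolding farey_pred_def
proof (rule the_equality)
  fix \<delta>
  assume "\<delta> \<in> farey (height \<beta>) \<and> \<delta> \<noteq> \<beta> \<and> arc_open \<delta> \<beta> \<inter> farey (height \<beta>) = {}"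
  then show "\<delta> = \<gamma>" using assms arc_open_total(1)[of \<gamma> \<delta> \<beta>] by blast
qed (use assms in blast)

lemma farey_succ_eqI:
  assumes "\<gamma> \<in> farey (height \<beta>)" "\<gamma> \<noteq> \<beta>" "arc_open \<beta> \<gamma> \<inter> farey (height \<beta>) = {}"
  shows "farey_succ \<beta> = \<gamma>"
  unfolding farey_succ_def
proof (rule the_equality)
  fix \<delta>
  assume "\<delta> \<in> farey (height \<beta>) \<and> \<delta> \<noteq> \<beta> \<and> arc_open \<beta> \<delta> \<inter> farey (height \<beta>) = {}"
  then show "\<delta> = \<gamma>" using assms arc_open_total(2)[of \<gamma> \<delta> \<beta>] by blast
qed (use assms in blast)

text \<open>A fraction \<open>r/s\<close> strictly between \<open>b/p\<close> and \<open>a/q\<close> satisfies \<open>s = q (rp - bs) + p (as - rq)\<close>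
  with both brackets at least 1.\<close>

lemma arc_open_unimodular_disjoint:
  fixes a b :: int and p q Q :: nat
  assumes pq: "p \<ge> 1" "q \<ge> 1" "p * q > 1" and det: "a * int p - b * int q = 1"
    and "Q < p + q"
  shows "arc_open (circle_of (real_of_int b / real p)) (circle_of (real_of_int a / real q))
    \<inter> farey Q = {}"
proof (rule ccontr)
  assume "\<not> ?thesis"
  then obtain t d where td: "0 < t" "t < d" "d < 1"
    and d: "circle_of d = circle_of (real_of_int a / real q) - circle_of (real_of_int b / real p)"
    and far: "circle_of (real_of_int b / real p) + circle_of t \<in> farey Q"
    by (auto simp: arc_open_def)
  have detR: "real_of_int a * real p - real_of_int b * real q = 1"
    using arg_cong[OF det, of real_of_int] by simp
  have diff: "real_of_int a / real q - real_of_int b / real p = 1 / real (p * q)"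
    using pq detR by (simp add: field_simps)
  have "real (p * q) > 1" using pq(3) by linarith
  \<comment> \<open>Both numbers represent the same point of the circle and lie in (0,1); the bound
    \<open>p * q > 1\<close> puts \<open>1 / real (p * q)\<close> there.\<close>
  then have "d = 1 / real (p * q)"
    using d td by (intro circle_of_unit_inj) (auto simp: circle_of_diff[symmetric] diff)
  then have t: "real_of_int b / real p + t < real_of_int a / real q"
    using td diff by linarith
  define s where "s = height (circle_of (real_of_int b / real p) + circle_of t)"
  obtain r0 :: int where r0: "s \<ge> 1"
    "circle_of (real_of_int b / real p + t) = circle_of (real_of_int r0 / real s)" "s \<le> Q"
    using far QmodZ_repr[of "circle_of (real_of_int b / real p) + circle_of t"]
    unfolding s_def farey_def circle_of_add by blast
  then obtain k where "real_of_int b / real p + t - real_of_int r0 / real s = of_int k"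
    by (auto simp: circle_of_eq_iff elim: Ints_cases)
  \<comment> \<open>Absorbing the integer shift \<open>k\<close> into the numerator gives a fraction
    of denominator \<open>s\<close> that lies between the two endpoints as real numbers.\<close>
  then have "real_of_int b / real p + t = real_of_int (r0 + k * int s) / real s"
    using r0(1) by (simp add: field_simps)
  then obtain r :: int where r: "real_of_int b / real p + t = real_of_int r / real s" ..
  have "real_of_int b / real p < real_of_int r / real s"
    "real_of_int r / real s < real_of_int a / real q"
    using r t td by linarith+
  then have "real_of_int (b * int s) < real_of_int (r * int p)"
    "real_of_int (r * int q) < real_of_int (a * int s)"
    using pq r0(1) by (simp_all add: field_simps)
  then have "r * int p - b * int s \<ge> 1" "a * int s - r * int q \<ge> 1"
    by (simp_all only: of_int_less_iff)
  then have "int q * 1 + int p * 1 \<le> int q * (r * int p - b * int s) + int p * (a * int s - r * int q)"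
    by (intro add_mono mult_left_mono) auto
  also have "\<dots> = int s * (a * int p - b * int q)" by (simp add: algebra_simps)
  finally have "q + p \<le> s" using det by simp
  then show False using r0(3) assms(5) by simp
qed

text \<open>Solve \<open>a * p - b * q = 1\<close> with \<open>1 \<le> p < q\<close>. Then b/p and
  (a-b)/(q-p) are the neighbours of a/q, which is their mediant; each forms a unimodular pair with
  a/q, so no fraction of denominator at most \<open>q\<close> lies between.\<close>

lemma farey_neighbours:
  assumes "\<beta> \<in> QmodZ" "\<beta> \<noteq> 0"
  shows "farey_pred \<beta> \<in> QmodZ" "farey_succ \<beta> \<in> QmodZ"
    and "farey_pred \<beta> \<noteq> \<beta>" "farey_succ \<beta> \<noteq> \<beta>"
    and "height (farey_pred \<beta>) \<ge> 1" "height (farey_succ \<beta>) \<ge> 1"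
    and "height \<beta> = height (farey_pred \<beta>) + height (farey_succ \<beta>)"
proof -
  define q where "q = height \<beta>"
  obtain a :: int where a: "q \<ge> 1" "coprime a (int q)" "\<beta> = circle_of (real_of_int a / real q)"
    using QmodZ_repr[OF assms(1)] unfolding q_def by blast
  have "q \<noteq> 1"
  proof
    assume "q = 1"
    then have "\<beta> = 0" using a(3) circle_of_eq_0_iff by simp
    with assms(2) show False ..
  qed
  then have q: "q \<ge> 2" using a(1) by simp
  obtain u v where uv: "u * a + v * int q = 1"
    using a(2) bezout_int[of a "int q"] by auto
  \<comment> \<open>\<open>p\<close> is the inverse of \<open>a\<close> modulo \<open>q\<close>.
    Replacing \<open>u\<close> by \<open>u - q * w\<close> in the Bezout identity forces the value
    of \<open>b\<close>.\<close>
  define p where "p = nat (u mod int q)"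
  define w where "w = u div int q"
  define b where "b = - v - a * w"
  have ip: "int p = u mod int q" using q by (simp add: p_def)
  then have ip': "int p = u - int q * w" by (simp add: w_def minus_mult_div_eq_mod)
  have det: "a * int p - b * int q = 1"
    using uv by (simp add: ip' b_def algebra_simps)
  have "p \<noteq> 0"
  proof
    assume "p = 0"
    then have "1 = int q * (- b)" using det by (simp add: mult.commute)
    then have "int q dvd 1" by (rule dvdI)
    then show False using q by simp
  qed
  moreover have "int p < int q" unfolding ip using q by simp
  ultimately have p: "p \<ge> 1" "p < q" by auto
  define p' where "p' = q - p"
  have p': "p' \<ge> 1" "p' < q" "q = p + p'" "int p' = int q - int p" using p by (auto simp: p'_def)
  have det': "(a - b) * int q - a * int p' = 1"
    using det by (simp add: p'(4) algebra_simps)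
  have cop: "coprime b (int p)"
  proof (rule coprimeI)
    fix c assume "c dvd b" "c dvd int p"
    then have "c dvd a * int p - b * int q" by simp
    then show "is_unit c" using det by simp
  qed
  have cop': "coprime (a - b) (int p')"
  proof (rule coprimeI)
    fix c assume "c dvd a - b" "c dvd int p'"
    then have "c dvd (a - b) * int q - a * int p'" by (intro dvd_diff) auto
    then show "is_unit c" using det' by simp
  qed
  define \<gamma> where "\<gamma> = circle_of (real_of_int b / real p)"
  define \<delta> where "\<delta> = circle_of (real_of_int (a - b) / real p')"
  have h: "height \<gamma> = p" "height \<delta> = p'"
    unfolding \<gamma>_def \<delta>_def by (intro height_circle_of p p' cop cop')+
  have Q: "\<gamma> \<in> QmodZ" "\<delta> \<in> QmodZ"
    unfolding \<gamma>_def \<delta>_def by (rule circle_of_rat_in_QmodZ)+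
  \<comment> \<open>Both neighbours have height less than \<open>q\<close>, the height of
    \<beta>.\<close>
  have ne: "\<gamma> \<noteq> \<beta>" "\<delta> \<noteq> \<beta>" using h p p' q_def by auto
  have "p * q > 1" "q * p' > 1"
    using mult_le_mono[OF p(1) q] mult_le_mono[OF q p'(1)] by linarith+
  then have "arc_open \<gamma> \<beta> \<inter> farey q = {}" "arc_open \<beta> \<delta> \<inter> farey q = {}"
    unfolding \<gamma>_def \<delta>_def a(3)
    using p(1) p'(1) a(1) det det' by (intro arc_open_unimodular_disjoint; simp)+
  then have "farey_pred \<beta> = \<gamma>" "farey_succ \<beta> = \<delta>"
    using Q h p p' ne by (auto intro!: farey_pred_eqI farey_succ_eqI simp: farey_def simp flip: q_def)
  then show "farey_pred \<beta> \<in> QmodZ" "farey_succ \<beta> \<in> QmodZ"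
    "farey_pred \<beta> \<noteq> \<beta>" "farey_succ \<beta> \<noteq> \<beta>"
    "height (farey_pred \<beta>) \<ge> 1" "height (farey_succ \<beta>) \<ge> 1"
    "height \<beta> = height (farey_pred \<beta>) + height (farey_succ \<beta>)"
    using Q ne h p p' q_def by simp_all
qed

section \<open>Local behaviour of the step functions\<close>

lemma psi_locally_affine:
  assumes "c \<noteq> b"
  shows "\<forall>\<^sub>F e in nhds 0. psi (c + circle_of e - b) = psi (c - b) + e"
proof -
  obtain r where r: "c - b = circle_of r" by (rule circle_of_surj)
  then have ni: "r \<notin> \<int>" using assms circle_of_eq_0_iff[of r] by auto
  from floor_eventually_const[OF this] show ?thesis
  proof eventually_elim
    case (elim e)
    have "c + circle_of e - b = circle_of (r + e)"
      unfolding circle_of_add r[symmetric] by simp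
    then show ?case using elim ni r by (simp add: psi.abs_eq psi_real_def)
  qed
qed

text \<open>At its singularity \<open>psi\<close> takes the value 0, while its limit from the right
  is -1/2.\<close>

lemma psi_right_increment:
  "\<forall>\<^sub>F e in at_right 0. psi (c + circle_of e - b) = psi (c - b) + e - (if c = b then 1/2 else 0)"
proof (cases "c = b")
  case True
  have "\<forall>\<^sub>F e in at_right 0. e \<in> {0<..<1::real}"
    by (rule eventually_at_right_real) simp
  then show ?thesis
  proof eventually_elim
    case (elim e)
    then have "\<lfloor>e\<rfloor> = 0" by (simp add: floor_unique)
    moreover from this elim have "e \<notin> \<int>" by (metis Ints_cases floor_of_int greaterThanLessThan_iff less_irrefl of_int_0)
    ultimately show ?case
      using True by (simp add: psi.abs_eq zero_circle.abs_eq psi_real_def)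
  qed
next
  case False
  have "at_right 0 \<le> nhds (0::real)" by (simp add: at_within_def)
  from filter_leD[OF this psi_locally_affine[OF False]] show ?thesis using False by simp
qed

text \<open>Each \<open>psi\<close> term has slope 1 here, and the three coefficients sum to zero
  because the heights of the neighbours add up to that of \<beta>.\<close>

lemma farey_fun_locally_constant:
  assumes "\<beta> \<in> QmodZ" "\<beta> \<noteq> 0" "c \<noteq> \<beta>" "c \<noteq> farey_pred \<beta>" "c \<noteq> farey_succ \<beta>"
  shows "\<forall>\<^sub>F e in nhds 0. farey_fun \<beta> (c + circle_of e) = farey_fun \<beta> c"
  using psi_locally_affine[OF assms(3)] psi_locally_affine[OF assms(4)]
    psi_locally_affine[OF assms(5)]
proof eventually_elim
  case (elim e)
  then show ?case
    using farey_neighbours(7)[OF assms(1,2)] assms(2)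
    by (simp add: farey_fun_def algebra_simps)
qed

text \<open>The drop of \<open>psi\<close> by 1/2 enters with a negative coefficient, so the
  function rises by half the height of the neighbour. The term centred at \<beta> has no jump at
  \<open>c\<close>, since \<beta> differs from its neighbours.\<close>

lemma farey_fun_jump:
  assumes "\<beta> \<in> QmodZ" "\<beta> \<noteq> 0" "c = farey_pred \<beta> \<or> c = farey_succ \<beta>"
  shows "\<forall>\<^sub>F e in at_right 0. farey_fun \<beta> (c + circle_of e) > farey_fun \<beta> c"
  using psi_right_increment[of c \<beta>] psi_right_increment[of c "farey_pred \<beta>"]
    psi_right_increment[of c "farey_succ \<beta>"]
proof eventually_elim
  case (elim e)
  note nb = farey_neighbours[OF assms(1,2)]
  \<comment> \<open>Two separate indicators, because the neighbours can coincide: for height 2 both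
    are 0. The jumps then add up instead of cancelling.\<close>
  define u v where "u = (if c = farey_pred \<beta> then 1/2 else 0 :: real)"
    and "v = (if c = farey_succ \<beta> then 1/2 else 0 :: real)"
  have "c \<noteq> \<beta>" using nb(3,4) assms(3) by metis
  then have psi: "psi (c + circle_of e - \<beta>) = psi (c - \<beta>) + e"
    "psi (c + circle_of e - farey_pred \<beta>) = psi (c - farey_pred \<beta>) + e - u"
    "psi (c + circle_of e - farey_succ \<beta>) = psi (c - farey_succ \<beta>) + e - v"
    using elim unfolding u_def v_def by simp_all
  have h: "real (height \<beta>) = real (height (farey_pred \<beta>)) + real (height (farey_succ \<beta>))"
    using nb(7) by linarith
  have "farey_fun \<beta> (c + circle_of e) = farey_fun \<beta> c +
      (real (height (farey_pred \<beta>)) * u + real (height (farey_succ \<beta>)) * v)"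
    unfolding farey_fun_def psi h if_not_P[OF assms(2)] by (simp add: ring_distribs)
  moreover have "u \<ge> 0" "v \<ge> 0" "u > 0 \<or> v > 0"
    using assms(3) by (auto simp: u_def v_def)
  then have "real (height (farey_pred \<beta>)) * u + real (height (farey_succ \<beta>)) * v > 0"
    using nb(5,6) by (auto intro: add_pos_nonneg add_nonneg_pos)
  ultimately show ?case by simp
qed

text \<open>Off \<open>S\<close> the function is locally constant, so a level set and its complement
  are both open there; two values on \<open>C\<close> would disconnect it.\<close>

lemma farey_fun_constant_on_connected:
  assumes "\<beta> \<in> QmodZ" "\<beta> \<noteq> 0" "{\<beta>, farey_pred \<beta>, farey_succ \<beta>} \<subseteq> S"
    and S: "finite S" and C: "connected C" "C \<subseteq> UNIV - S" "x \<in> C" "y \<in> C"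
  shows "farey_fun \<beta> x = farey_fun \<beta> y"
proof (rule ccontr)
  assume neq: "farey_fun \<beta> x \<noteq> farey_fun \<beta> y"
  \<comment> \<open>An arbitrary predicate \<open>P\<close> covers the level set and its complement
    at once. Openness is tested on the preimage in the reals, by definition of the quotient
    topology.\<close>
  have op: "open {z. z \<notin> S \<and> P (farey_fun \<beta> z)}" for P
    unfolding open_circle_def
  proof (subst open_subopen, intro ballI)
    fix t assume "t \<in> circle_of -` {z. z \<notin> S \<and> P (farey_fun \<beta> z)}"
    then have t: "circle_of t \<notin> S" "P (farey_fun \<beta> (circle_of t))" by auto
    then have "\<forall>\<^sub>F e in nhds 0. farey_fun \<beta> (circle_of t + circle_of e) = farey_fun \<beta> (circle_of t)"
      using assms by (intro farey_fun_locally_constant) auto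
    moreover have "\<forall>\<^sub>F e in nhds 0. \<forall>b\<in>S. circle_of t + circle_of e \<noteq> b"
      using t S by (intro eventually_ball_finite ballI eventually_ne_circle_of) auto
    ultimately have "\<forall>\<^sub>F e in nhds 0. t + e \<in> circle_of -` {z. z \<notin> S \<and> P (farey_fun \<beta> z)}"
      by eventually_elim (use t(2) in \<open>auto simp: circle_of_add\<close>)
    then obtain d where d: "d > 0"
      "\<And>e. \<bar>e\<bar> < d \<Longrightarrow> t + e \<in> circle_of -` {z. z \<notin> S \<and> P (farey_fun \<beta> z)}"
      unfolding eventually_nhds_metric by (auto simp: dist_real_def)
    have "ball t d \<subseteq> circle_of -` {z. z \<notin> S \<and> P (farey_fun \<beta> z)}"
    proof
      fix u assume "u \<in> ball t d"
      then show "u \<in> circle_of -` {z. z \<notin> S \<and> P (farey_fun \<beta> z)}"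
        using d(2)[of "u - t"] by (simp add: dist_real_def abs_minus_commute)
    qed
    then show "\<exists>T. open T \<and> t \<in> T \<and> T \<subseteq> circle_of -` {z. z \<notin> S \<and> P (farey_fun \<beta> z)}"
      using d(1) by (intro exI[of _ "ball t d"]) auto
  qed
  have "{z. z \<notin> S \<and> farey_fun \<beta> z = farey_fun \<beta> x} \<inter> C = {} \<or>
      {z. z \<notin> S \<and> farey_fun \<beta> z \<noteq> farey_fun \<beta> x} \<inter> C = {}"
    using C(2) by (intro connectedD[OF C(1) op op]) auto
  moreover have "x \<notin> S" "y \<notin> S" using C(2-4) by auto
  ultimately show False using C(3,4) neq by auto
qed

section \<open>The algebras \<open>B\<^sub>n\<close>\<close>

text \<open>Every component contains a small arc, hence a point of \<open>QmodZ\<close>, and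
  distinct components are disjoint. Countability allows arbitrary unions of generators of
  \<open>B_alg\<close>.\<close>

lemma countable_components_complement:
  fixes S :: "circle set"
  assumes "finite S"
  shows "countable (components (UNIV - S))"
proof -
  have meets: "C \<inter> QmodZ \<noteq> {}" if C: "C \<in> components (UNIV - S)" for C
  proof -
    obtain c where c: "c \<in> C" using in_components_nonempty[OF C] by blast
    then have "c \<notin> S" using in_components_subset[OF C] by auto
    then obtain d where d: "d > 0" "connected ((\<lambda>e. c + circle_of e) ` {-d<..<d})"
      "(\<lambda>e. c + circle_of e) ` {-d<..<d} \<subseteq> UNIV - S"
      using connected_neighbourhood_avoiding assms by metis
    have "c \<in> (\<lambda>e. c + circle_of e) ` {-d<..<d}"
      using d(1) by (intro image_eqI[of _ _ 0]) (auto simp: zero_circle.abs_eq[symmetric])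
    then have sub: "(\<lambda>e. c + circle_of e) ` {-d<..<d} \<subseteq> C"
      using components_maximal[OF C d(2,3)] c by auto
    obtain r where r: "c = circle_of r" by (rule circle_of_surj)
    obtain u where u: "u \<in> \<rat>" "r - d < u" "u < r + d"
      using Rats_dense_in_real[of "r - d" "r + d"] d(1) by auto
    have "circle_of u = c + circle_of (u - r)" by (simp add: r circle_of_add[symmetric])
    then have "circle_of u \<in> C" using u sub by auto
    moreover have "circle_of u \<in> QmodZ" using u(1) by (simp add: QmodZ_def)
    ultimately show ?thesis by blast
  qed
  define pt where "pt C = (SOME z. z \<in> C \<inter> QmodZ)" for C
  have pt: "pt C \<in> C \<inter> QmodZ" if "C \<in> components (UNIV - S)" for C
    unfolding pt_def using meets[OF that] some_in_eq by metis
  have "inj_on pt (components (UNIV - S))"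
  proof (rule inj_onI)
    fix C D assume CD: "C \<in> components (UNIV - S)" "D \<in> components (UNIV - S)" "pt C = pt D"
    then have "C \<inter> D \<noteq> {}" using pt[OF CD(1)] pt[OF CD(2)] by auto
    then show "C = D" using CD components_nonoverlap by blast
  qed
  moreover have "countable (pt ` components (UNIV - S))"
  proof (rule countable_subset)
    show "pt ` components (UNIV - S) \<subseteq> QmodZ" using pt by blast
    show "countable QmodZ" by (simp add: QmodZ_def countable_rat)
  qed
  ultimately show ?thesis using countable_image_inj_on by blast
qed

lemma space_B_alg [simp]: "space (B_alg \<beta> n) = UNIV"
  by (simp add: B_alg_def)

lemma sets_B_alg:
  "sets (B_alg \<beta> n) = sigma_sets UNIV
     (components (UNIV - \<beta> ` {1..n}) \<union> {{\<beta> i} | i. i \<in> {1..n}})"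
  by (simp add: B_alg_def)

text \<open>The generators partition the circle into sets on which \<open>f\<close> is constant, so
  every preimage is the union of the generators it contains, a countable union.\<close>

lemma B_alg_measurableI:
  assumes const: "\<And>C x y. C \<in> components (UNIV - \<beta> ` {1..n}) \<Longrightarrow> x \<in> C \<Longrightarrow> y \<in> C \<Longrightarrow> f x = f y"
  shows "f \<in> borel_measurable (B_alg \<beta> n)"
proof (rule measurableI)
  fix A :: "'a set"
  define G where "G = components (UNIV - \<beta> ` {1..n}) \<union> {{\<beta> i} | i. i \<in> {1..n}}"
  have "countable G"
    unfolding G_def using countable_components_complement[of "\<beta> ` {1..n}"]
    by (auto simp: setcompr_eq_image intro: countable_finite)
  then have "countable {X \<in> G. X \<subseteq> f -` A}" by (rule countable_subset[rotated]) blast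
  moreover have "G \<subseteq> sets (B_alg \<beta> n)" unfolding sets_B_alg G_def[symmetric] by blast
  ultimately have "\<Union>{X \<in> G. X \<subseteq> f -` A} \<in> sets (B_alg \<beta> n)"
    by (intro sets.countable_Union) auto
  moreover have "\<Union>{X \<in> G. X \<subseteq> f -` A} = f -` A"
  proof (intro equalityI subsetI)
    fix x assume x: "x \<in> f -` A"
    show "x \<in> \<Union>{X \<in> G. X \<subseteq> f -` A}"
    proof (cases "x \<in> \<beta> ` {1..n}")
      case True
      then have "{x} \<in> G" by (auto simp: G_def)
      then show ?thesis using x by blast
    next
      case False
      then obtain C where C: "C \<in> components (UNIV - \<beta> ` {1..n})" "x \<in> C"
        using Union_components[of "UNIV - \<beta> ` {1..n}"] by blast
      have "C \<subseteq> f -` A"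
      proof
        fix y assume "y \<in> C"
        from const[OF C this] x show "y \<in> f -` A" by simp
      qed
      then show ?thesis using C by (auto simp: G_def)
    qed
  qed auto
  ultimately show "f -` A \<inter> space (B_alg \<beta> n) \<in> sets (B_alg \<beta> n)" by simp
qed simp

text \<open>No generator separates \<open>x\<close> from \<open>y\<close>: a component containing
  one contains all of \<open>C\<close>, and the singletons miss \<open>C\<close>. This property
  survives complements and countable unions, and the fibre of \<open>f x\<close> is measurable
  because points are closed.\<close>

lemma B_alg_measurable_constant_on_connected:
  fixes f :: "circle \<Rightarrow> 'a :: t1_space"
  assumes f: "f \<in> borel_measurable (B_alg \<beta> n)"
    and C: "connected C" "C \<subseteq> UNIV - \<beta> ` {1..n}" "x \<in> C" "y \<in> C"
  shows "f x = f y"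
proof -
  define G where "G = components (UNIV - \<beta> ` {1..n}) \<union> {{\<beta> i} | i. i \<in> {1..n}}"
  have gen: "x \<in> X \<longleftrightarrow> y \<in> X" if "X \<in> G" for X
    using that unfolding G_def
  proof
    assume "X \<in> components (UNIV - \<beta> ` {1..n})"
    from components_maximal[OF this C(1,2)] show ?thesis using C(3,4) by blast
  next
    assume "X \<in> {{\<beta> i} | i. i \<in> {1..n}}"
    then show ?thesis using C(2-4) by blast
  qed
  have "x \<in> X \<longleftrightarrow> y \<in> X" if "X \<in> sigma_sets UNIV G" for X
    using that by (induction rule: sigma_sets.induct) (auto simp: gen)
  moreover have "f -` {f x} \<inter> space (B_alg \<beta> n) \<in> sets (B_alg \<beta> n)"
    using f by (rule measurable_sets) (simp add: borel_closed)
  then have "f -` {f x} \<in> sigma_sets UNIV G"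
    by (simp add: sets_B_alg G_def)
  ultimately have "y \<in> f -` {f x}" by blast
  then show ?thesis by simp
qed

text \<open>A neighbour missing from the first \<open>n\<close> points would have an arc around it
  on which measurability forces constancy, against the jump. Conversely, once all three singular
  points are listed, the function is constant on each component.\<close>

lemma farey_fun_measurable_iff:
  assumes "\<beta> n \<in> QmodZ" "\<beta> n \<noteq> 0" "n \<ge> 1"
  shows "farey_fun (\<beta> n) \<in> borel_measurable (B_alg \<beta> n) \<longleftrightarrow>
    farey_pred (\<beta> n) \<in> \<beta> ` {1..n} \<and> farey_succ (\<beta> n) \<in> \<beta> ` {1..n}"
proof
  assume meas: "farey_fun (\<beta> n) \<in> borel_measurable (B_alg \<beta> n)"
  have "c \<in> \<beta> ` {1..n}" if c: "c = farey_pred (\<beta> n) \<or> c = farey_succ (\<beta> n)" for c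
  proof (rule ccontr)
    assume "c \<notin> \<beta> ` {1..n}"
    then obtain d where d: "d > 0" "connected ((\<lambda>e. c + circle_of e) ` {-d<..<d})"
      "(\<lambda>e. c + circle_of e) ` {-d<..<d} \<subseteq> UNIV - \<beta> ` {1..n}"
      using connected_neighbourhood_avoiding by (metis finite_atLeastAtMost finite_imageI)
    have mem: "c \<in> (\<lambda>e. c + circle_of e) ` {-d<..<d}"
      using d(1) by (intro image_eqI[of _ _ 0]) (auto simp: zero_circle.abs_eq[symmetric])
    have "\<forall>\<^sub>F e in at_right 0. e \<in> {0<..<d}"
      using d(1) by (rule eventually_at_right_real)
    with farey_fun_jump[OF assms(1,2) c]
    \<comment> \<open>Points just to the right of \<open>c\<close> would have both the same value as
      \<open>c\<close> and a larger one; \<open>at_right 0\<close> is a nontrivial filter, so this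
      is absurd.\<close>
    have "\<forall>\<^sub>F e in at_right (0::real). False"
    proof eventually_elim
      case (elim e)
      then have "c + circle_of e \<in> (\<lambda>e. c + circle_of e) ` {-d<..<d}" by auto
      then show ?case
        using B_alg_measurable_constant_on_connected[OF meas d(2,3) mem] elim by force
    qed
    then show False by (simp add: trivial_limit_at_right_real)
  qed
  then show "farey_pred (\<beta> n) \<in> \<beta> ` {1..n} \<and> farey_succ (\<beta> n) \<in> \<beta> ` {1..n}" by blast
next
  assume "farey_pred (\<beta> n) \<in> \<beta> ` {1..n} \<and> farey_succ (\<beta> n) \<in> \<beta> ` {1..n}"
  then have "{\<beta> n, farey_pred (\<beta> n), farey_succ (\<beta> n)} \<subseteq> \<beta> ` {1..n}" using assms(3) by auto
  then show "farey_fun (\<beta> n) \<in> borel_measurable (B_alg \<beta> n)"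
    by (intro B_alg_measurableI farey_fun_constant_on_connected[OF assms(1,2)])
      (auto dest: in_components_connected in_components_subset)
qed

theorem theorem6:
  fixes \<beta> :: "nat \<Rightarrow> circle"
  assumes "enumeration \<beta>"
  shows "admissible \<beta> \<longleftrightarrow> (\<forall>n\<ge>1. farey_fun (\<beta> n) \<in> borel_measurable (B_alg \<beta> n))"
proof -
  have inj: "i = j" if "\<beta> i = \<beta> j" "i \<ge> 1" "j \<ge> 1" for i j
    using assms that by (auto simp: enumeration_def bij_betw_def inj_on_def)
  have img: "\<beta> ` {1..} = QmodZ"
    using assms by (simp add: enumeration_def bij_betw_def)
  then have Q: "\<beta> n \<in> QmodZ" if "n \<ge> 1" for n using that by auto
  have idx: "\<exists>k\<ge>1. \<beta> k = x" if "x \<in> QmodZ" for x using that unfolding img[symmetric] by auto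
  show ?thesis
  proof (intro iffI allI impI)
    fix n :: nat
    assume adm: "admissible \<beta>" and n: "n \<ge> 1"
    show "farey_fun (\<beta> n) \<in> borel_measurable (B_alg \<beta> n)"
    proof (cases "\<beta> n = 0")
      case True
      then have "farey_fun (\<beta> n) = (\<lambda>x. 1)" by (auto simp: farey_fun_def)
      then show ?thesis by simp
    next
      case False
      \<comment> \<open>Admissibility constrains neighbours only from index 2 on; \<beta> 1 = 0
        removes the remaining index.\<close>
      then have "n \<noteq> 1" using adm by (auto simp: admissible_def)
      then have n2: "n \<ge> 2" using n by simp
      note nb = farey_neighbours[OF Q[OF n] False]
      obtain k l where "k \<ge> 1" "\<beta> k = farey_pred (\<beta> n)" "l \<ge> 1" "\<beta> l = farey_succ (\<beta> n)"
        using idx nb(1,2) by metis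
      moreover from this have "k < n" "l < n" using adm n2 by (auto simp: admissible_def)
      ultimately have "farey_pred (\<beta> n) \<in> \<beta> ` {1..n} \<and> farey_succ (\<beta> n) \<in> \<beta> ` {1..n}"
        by (metis atLeastAtMost_iff image_eqI less_imp_le)
      then show ?thesis using farey_fun_measurable_iff[of \<beta> n, OF Q[OF n] False n] by blast
    qed
  next
    assume meas: "\<forall>n\<ge>1. farey_fun (\<beta> n) \<in> borel_measurable (B_alg \<beta> n)"
    \<comment> \<open>The index range excludes \<open>n\<close>, since a neighbour of \<beta> n is
      never \<beta> n itself.\<close>
    have nbr: "farey_pred (\<beta> n) \<in> \<beta> ` {1..<n} \<and> farey_succ (\<beta> n) \<in> \<beta> ` {1..<n}"
      if "n \<ge> 1" "\<beta> n \<noteq> 0" for n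
    proof -
      have "farey_pred (\<beta> n) \<in> \<beta> ` {1..n}" "farey_succ (\<beta> n) \<in> \<beta> ` {1..n}"
        using farey_fun_measurable_iff[of \<beta> n, OF Q[OF that(1)] that(2,1)] meas that(1) by auto
      moreover have "{1..n} = insert n {1..<n}" using that(1) by auto
      ultimately show ?thesis using farey_neighbours(3,4)[OF Q[OF that(1)] that(2)] by auto
    qed
    \<comment> \<open>For \<open>n = 1\<close> the index range in \<open>nbr\<close> is empty, so a
      nonzero first point is impossible.\<close>
    have zero: "\<beta> 1 = 0" using nbr[of 1] by auto
    have "k < m" if "m \<ge> 2" "k \<ge> 1" "\<beta> k = farey_pred (\<beta> m) \<or> \<beta> k = farey_succ (\<beta> m)" for m k
    proof -
      \<comment> \<open>The value 0 is already taken by index 1, and the enumeration is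
        injective.\<close>
      have "\<beta> m \<noteq> 0" using inj[of m 1] zero that(1) by auto
      then have "\<beta> k \<in> \<beta> ` {1..<m}" using nbr[of m] that by auto
      then obtain i where "\<beta> k = \<beta> i" "i \<ge> 1" "i < m" by auto
      then show ?thesis using inj[of k i] that(2) by simp
    qed
    then show "admissible \<beta>" using zero by (auto simp: admissible_def)
  qed
qed

end
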